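(* Let $p>2$ be a prime and $a\in\mathbb{Z}$. Then $U^3\vdash^M_\gamma\Psi$, where $\Psi$ is the linear datum with index set $[4]$, $V=\mathbb{F}_p^4$, $W_1=W_2=\mathbb{F}_p$, $W_3=W_4=\mathbb{F}_p^3$, $\phi_1(x,y,z,w)=x+az+w$, $\phi_2(x,y,z,w)=y+z+aw$, $\phi_3(x,y,z,w)=(x,y,w)$, $\phi_4(x,y,z,w)=(x,y,z)$; $M=6+\lfloor\log_2\lfloor\log_2(|a|-1)\rfloor\rfloor$ if $|a|\ge4$ and $M=5$ if $|a|<4$; and $\gamma(1)=(000,0)$, $\gamma(2)=(000,1)$ (and $\gamma$ undefined at $3,4$).
   Context: A linear datum $(I,V,(W_\ell),(\phi_\ell))$: finite index set, finite-dimensional $\mathbb{F}_p$-spaces, linear maps $\phi_\ell\colon V\to W_\ell$. $U^3$ is the datum with index set $\{0,1\}^3$, $V=\mathbb{F}_p^4$, $W_\omega=\mathbb{F}_p$, $\phi_\omega(x,h_1,h_2,h_3)=x+\omega_1h_1+\omega_2h_2+\omega_3h_3$. Morphisms: with $W_*=\{0\}$, $\phi_*=0$, a morphism $\Psi'\to\Phi$ of shape $\alpha\colon I^\Phi\to I^{\Psi'}\cup\{*\}$ is a linear $\theta\colon V^{\Psi'}\to V^\Phi$ with linear $\sigma_j\colon W^{\Psi'}_{\alpha(j)}\to W^\Phi_j$ such that $\sigma_j\circ\phi^{\Psi'}_{\alpha(j)}=\phi^\Phi_j\circ\theta$; it respects $j$ if $\alpha(j)\ne*$, $j$ is the only index mapped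 to $\alpha(j)$, $W^\Phi_j=W^{\Psi'}_{\alpha(j)}$ and $\sigma_j=\mathrm{id}$. Self-joining $\Phi+_S\Phi$ ($S\subseteq I^\Phi$): indices $(L,i),(R,i)$ for $i\notin S$, space $\{(v_0,v_1)\in V\oplus V:\phi_i(v_0)=\phi_i(v_1)\,\forall i\in S\}$, maps $\phi_i(v_0)$, $\phi_i(v_1)$. For a partial $\gamma\colon I^{\Psi'}\to I^\Phi\times\{0,1\}$, $\Phi\vdash^k_\gamma\Psi'$ holds if: (a) a morphism $\Theta\colon\Psi'\to\Phi$ exists, $k=0$, $\gamma=\{\alpha^\Theta(i)\mapsto(i,0):\Theta\text{ respects }i\}$; or (b) $\Psi'=\Phi+_S\Phi$, $\gamma(L,i)=(i,0)$, $\gamma(R,i)=(i,1)$ for $i\notin S$; or (c) $\Phi\vdash^{k_1}_{\gamma_1}\Xi$ and $\Xi\vdash^{k_2}_{\gamma_2}\Psi'$ with $k=k_1+k_2$ and $\gamma(j)=(i,a_1+a_2\bmod2)$ whenever $\gamma_2(j)=(\ell,a_2)$, $\gamma_1(\ell)=(i,a_1)$; or (d) $\Phi\vdash^{k'}_{\gamma'}\Psi'$ with $k'\le k$ and $\gamma$ a restriction of $\gamma'$. *)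

theory Defs 
  imports
    Complex_Main
    "Jordan_Normal_Form.VS_Connect"
    "Berlekamp_Zassenhaus.Finite_Field"
begin

text \<open>
  The entailment relation below quantifies over linear data with varying index sets and varying
  vector spaces, so both live in fixed universes.  Index sets are finite subsets of the type
  \<open>index\<close>, which is closed under the tags \<open>L\<close> and \<open>R\<close>.  Finite-dimensional spaces are subspaces
  of coordinate spaces \<open>F\<^sup>n\<close>, with \<open>n\<close> arbitrary and possibly different for each space; the
  pair \<open>(v\<^sub>0, v\<^sub>1) \<in> F\<^sup>n \<oplus> F\<^sup>n\<close> is the concatenation \<open>v\<^sub>0 @\<^sub>v v\<^sub>1 \<in> F\<^sup>2\<^sup>n\<close>, and the
  field itself is \<open>F\<^sup>1\<close>.
\<close>

datatype index =
    Num nat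
  | Cube nat nat nat
  | L index
  | R index

record 'f datum =
  idx :: "index set"
  src :: "'f vec set"
  tgt :: "index \<Rightarrow> 'f vec set"
  form :: "index \<Rightarrow> 'f vec \<Rightarrow> 'f vec"

definition fd_space :: "'f::field vec set \<Rightarrow> bool" where
  "fd_space V \<longleftrightarrow> (\<exists>n. VectorSpace.subspace class_ring V (module_vec TYPE('f) n))"

definition lin_map :: "'f::field vec set \<Rightarrow> 'f vec set \<Rightarrow> ('f vec \<Rightarrow> 'f vec) \<Rightarrow> bool" where
  "lin_map V W f \<longleftrightarrow>
     (\<forall>v\<in>V. f v \<in> W) \<and>
     (\<forall>u\<in>V. \<forall>v\<in>V. f (u + v) = f u + f v) \<and>
     (\<forall>c. \<forall>v\<in>V. f (c \<cdot>\<^sub>v v) = c \<cdot>\<^sub>v f v)"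

definition linear_datum :: "'f::field datum \<Rightarrow> bool" where
  "linear_datum \<Phi> \<longleftrightarrow>
     finite (idx \<Phi>) \<and> fd_space (src \<Phi>) \<and>
     (\<forall>i\<in>idx \<Phi>. fd_space (tgt \<Phi> i) \<and> lin_map (src \<Phi>) (tgt \<Phi> i) (form \<Phi> i))"

text \<open>The extra index \<open>*\<close>, carrying the zero space \<open>F\<^sup>0\<close> and the zero map, is \<open>None\<close>.\<close>

definition tgt_star :: "'f::field datum \<Rightarrow> index option \<Rightarrow> 'f vec set" where
  "tgt_star \<Phi> l = (case l of None \<Rightarrow> carrier_vec 0 | Some i \<Rightarrow> tgt \<Phi> i)"

definition form_star :: "'f::field datum \<Rightarrow> index option \<Rightarrow> 'f vec \<Rightarrow> 'f vec" where
  "form_star \<Phi> l = (case l of None \<Rightarrow> (\<lambda>v. 0\<^sub>v 0) | Some i \<Rightarrow> form \<Phi> i)"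

definition datum_morphism ::
  "'f::field datum \<Rightarrow> 'f datum \<Rightarrow> (index \<Rightarrow> index option) \<Rightarrow>
   ('f vec \<Rightarrow> 'f vec) \<Rightarrow> (index \<Rightarrow> 'f vec \<Rightarrow> 'f vec) \<Rightarrow> bool" where
  "datum_morphism \<Psi> \<Phi> \<alpha> \<theta> \<sigma> \<longleftrightarrow>
     (\<forall>j\<in>idx \<Phi>. \<alpha> j \<in> insert None (Some ` idx \<Psi>)) \<and>
     lin_map (src \<Psi>) (src \<Phi>) \<theta> \<and>
     (\<forall>j\<in>idx \<Phi>. lin_map (tgt_star \<Psi> (\<alpha> j)) (tgt \<Phi> j) (\<sigma> j) \<and>
        (\<forall>v\<in>src \<Psi>. \<sigma> j (form_star \<Psi> (\<alpha> j) v) = form \<Phi> j (\<theta> v)))"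

definition respects_idx ::
  "'f::field datum \<Rightarrow> 'f datum \<Rightarrow> (index \<Rightarrow> index option) \<Rightarrow>
   (index \<Rightarrow> 'f vec \<Rightarrow> 'f vec) \<Rightarrow> index \<Rightarrow> bool" where
  "respects_idx \<Psi> \<Phi> \<alpha> \<sigma> j \<longleftrightarrow>
     \<alpha> j \<noteq> None \<and> (\<forall>j'\<in>idx \<Phi>. \<alpha> j' = \<alpha> j \<longrightarrow> j' = j) \<and>
     tgt \<Phi> j = tgt_star \<Psi> (\<alpha> j) \<and> (\<forall>w\<in>tgt \<Phi> j. \<sigma> j w = w)"

text \<open>The components \<open>v\<^sub>0\<close> and \<open>v\<^sub>1\<close> of a concatenation \<open>v\<^sub>0 @\<^sub>v v\<^sub>1\<close> of two vectors of equal
  length.\<close>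

definition left_half :: "'f vec \<Rightarrow> 'f vec" where
  "left_half v = vec_first v (dim_vec v div 2)"

definition right_half :: "'f vec \<Rightarrow> 'f vec" where
  "right_half v = vec_last v (dim_vec v div 2)"

definition self_join :: "'f::field datum \<Rightarrow> index set \<Rightarrow> 'f datum" where
  "self_join \<Phi> S = \<lparr>
     idx = L ` (idx \<Phi> - S) \<union> R ` (idx \<Phi> - S),
     src = {v\<^sub>0 @\<^sub>v v\<^sub>1 | v\<^sub>0 v\<^sub>1. v\<^sub>0 \<in> src \<Phi> \<and> v\<^sub>1 \<in> src \<Phi> \<and> (\<forall>i\<in>S. form \<Phi> i v\<^sub>0 = form \<Phi> i v\<^sub>1)},
     tgt = (\<lambda>j. case j of L i \<Rightarrow> tgt \<Phi> i | R i \<Rightarrow> tgt \<Phi> i | _ \<Rightarrow> undefined),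
     form = (\<lambda>j v. case j of L i \<Rightarrow> form \<Phi> i (left_half v)
                           | R i \<Rightarrow> form \<Phi> i (right_half v) | _ \<Rightarrow> undefined)\<rparr>"

type_synonym labelling = "index \<rightharpoonup> index \<times> nat"

definition join_labelling :: "'f datum \<Rightarrow> index set \<Rightarrow> labelling" where
  "join_labelling \<Phi> S = (\<lambda>j. case j of
       L i \<Rightarrow> if i \<in> idx \<Phi> - S then Some (i, 0) else None
     | R i \<Rightarrow> if i \<in> idx \<Phi> - S then Some (i, 1) else None
     | _ \<Rightarrow> None)"

definition comp_labelling :: "labelling \<Rightarrow> labelling \<Rightarrow> labelling" where
  "comp_labelling \<gamma>\<^sub>1 \<gamma>\<^sub>2 = (\<lambda>j. case \<gamma>\<^sub>2 j of
       None \<Rightarrow> None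
     | Some (l, a\<^sub>2) \<Rightarrow> (case \<gamma>\<^sub>1 l of None \<Rightarrow> None | Some (i, a\<^sub>1) \<Rightarrow> Some (i, (a\<^sub>1 + a\<^sub>2) mod 2)))"

text \<open>\<open>entails \<Phi> k \<gamma> \<Psi>\<close> is \<open>\<Phi> \<turnstile>\<^sup>k\<^sub>\<gamma> \<Psi>\<close>; the number \<open>k\<close> bounds the number of self-joinings.\<close>

inductive entails :: "'f::field datum \<Rightarrow> nat \<Rightarrow> labelling \<Rightarrow> 'f datum \<Rightarrow> bool" where
  morphism:
    "\<lbrakk>linear_datum \<Phi>; linear_datum \<Psi>; datum_morphism \<Psi> \<Phi> \<alpha> \<theta> \<sigma>;
      Map.graph \<gamma> = {(l, (i, 0)) | l i. i \<in> idx \<Phi> \<and> respects_idx \<Psi> \<Phi> \<alpha> \<sigma> i \<and> \<alpha> i = Some l}\<rbrakk>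
     \<Longrightarrow> entails \<Phi> 0 \<gamma> \<Psi>"
| self_joining:
    "\<lbrakk>linear_datum \<Phi>; S \<subseteq> idx \<Phi>\<rbrakk>
     \<Longrightarrow> entails \<Phi> 1 (join_labelling \<Phi> S) (self_join \<Phi> S)"
| composition:
    "\<lbrakk>entails \<Phi> k\<^sub>1 \<gamma>\<^sub>1 \<Xi>; entails \<Xi> k\<^sub>2 \<gamma>\<^sub>2 \<Psi>\<rbrakk>
     \<Longrightarrow> entails \<Phi> (k\<^sub>1 + k\<^sub>2) (comp_labelling \<gamma>\<^sub>1 \<gamma>\<^sub>2) \<Psi>"
| weakening:
    "\<lbrakk>entails \<Phi> k' \<gamma>' \<Psi>; k' \<le> k; \<gamma> \<subseteq>\<^sub>m \<gamma>'\<rbrakk>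
     \<Longrightarrow> entails \<Phi> k \<gamma> \<Psi>"

definition U3 :: "'f::field datum" where
  "U3 = \<lparr>
     idx = {Cube \<omega>\<^sub>1 \<omega>\<^sub>2 \<omega>\<^sub>3 | \<omega>\<^sub>1 \<omega>\<^sub>2 \<omega>\<^sub>3. \<omega>\<^sub>1 \<in> {0, 1} \<and> \<omega>\<^sub>2 \<in> {0, 1} \<and> \<omega>\<^sub>3 \<in> {0, 1}},
     src = carrier_vec 4,
     tgt = (\<lambda>_. carrier_vec 1),
     form = (\<lambda>j v. case j of
         Cube \<omega>\<^sub>1 \<omega>\<^sub>2 \<omega>\<^sub>3 \<Rightarrow> vec_of_list
           [v $ 0 + of_nat \<omega>\<^sub>1 * v $ 1 + of_nat \<omega>\<^sub>2 * v $ 2 + of_nat \<omega>\<^sub>3 * v $ 3]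
       | _ \<Rightarrow> undefined)\<rparr>"

text \<open>The vector \<open>(x, y, z, w)\<close> is \<open>v\<close> with \<open>x = v $ 0\<close>, \<open>y = v $ 1\<close>, \<open>z = v $ 2\<close>, \<open>w = v $ 3\<close>.\<close>

definition Psi :: "int \<Rightarrow> 'f::field datum" where
  "Psi a = \<lparr>
     idx = {Num 1, Num 2, Num 3, Num 4},
     src = carrier_vec 4,
     tgt = (\<lambda>j. if j = Num 1 \<or> j = Num 2 then carrier_vec 1 else carrier_vec 3),
     form = (\<lambda>j v.
       if j = Num 1 then vec_of_list [v $ 0 + of_int a * v $ 2 + v $ 3]
       else if j = Num 2 then vec_of_list [v $ 1 + v $ 2 + of_int a * v $ 3]
       else if j = Num 3 then vec_of_list [v $ 0, v $ 1, v $ 3]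
       else vec_of_list [v $ 0, v $ 1, v $ 2])\<rparr>"

definition join_bound :: "int \<Rightarrow> nat" where
  "join_bound a =
     (if \<bar>a\<bar> \<ge> 4
      then 6 + nat \<lfloor>log 2 (real_of_int \<lfloor>log 2 (real_of_int (\<bar>a\<bar> - 1))\<rfloor>)\<rfloor>
      else 5)"

end

theory Submission
  imports Defs "HOL-Library.Product_Plus"
begin

text \<open>
  Write \<open>f\<close> for the function at the vertex \<open>000\<close>. Two self-joinings of \<open>U\<^sup>3\<close> give a datum whose
  surviving copies of \<open>f\<close> may be evaluated at any parallelogram of linear forms in \<open>x, y, z, w\<close>;
  the other surviving functions then only see differences of these forms. If all differences avoid
  \<open>z\<close>, or all avoid \<open>w\<close>, those functions can be absorbed into the last two forms of \<open>\<Psi>\<close>.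
  Ignoring \<open>x\<close> and \<open>y\<close>, write \<open>(\<alpha>, \<beta>)\<close> for \<open>f(\<alpha>z + \<beta>w)\<close>. For \<open>\<delta> \<in> {0, 1}\<close>, the parallelograms
  with diagonals
    \<open>{(2r - \<delta>, b), (\<delta>, b)}\<close>, \<open>{(r, b), (r, b)}\<close> and \<open>{(r, 2b), (r, 0)}\<close>, \<open>{(r, b), (r, b)}\<close>,
  joined along their common diagonal, trade \<open>(2r - \<delta>, b)\<close> for \<open>(r, 2b)\<close> at the cost of the side term
  \<open>(\<delta>, b)\<close>. Likewise
    \<open>{(1, (2r - \<delta>)b), (1, \<delta>b)}\<close>, \<open>{(1, 2rb), (1, 0)}\<close> and \<open>{(1, 2rb), (1, 0)}\<close> twice
  trade \<open>(1, (2r - \<delta>)b)\<close> for \<open>(1, 2rb)\<close> at the cost of \<open>(1, \<delta>b)\<close>, which is the same side term if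
  \<open>\<delta> = 1\<close>, and both side terms can be absorbed if \<open>\<delta> = 0\<close>. Each self-joining at an end of a chain of
  such trades doubles its length, so \<open>k\<close> of them process \<open>2\<^sup>k\<close> binary digits of \<open>a\<close> and lead from
  \<open>(a, 1)\<close> and from \<open>(1, a)\<close> to the same term, or to absorbable ones. One final self-joining of the
  two chains along all their common terms leaves exactly \<open>(a, 1)\<close> and \<open>(1, a)\<close>.
\<close>

subsection \<open>Spaces, halves and self-joinings\<close>

lemma fd_space_iff:
  fixes V :: "'f::field vec set"
  shows "fd_space V \<longleftrightarrow> (\<exists>n. V \<subseteq> carrier_vec n \<and> 0\<^sub>v n \<in> V \<and>
     (\<forall>u\<in>V. \<forall>v\<in>V. u + v \<in> V) \<and> (\<forall>c. \<forall>v\<in>V. c \<cdot>\<^sub>v v \<in> V))"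
  unfolding fd_space_def VectorSpace.subspace_def submodule_def
  using vec_vs[where 'a='f] vec_module[where 'a='f]
  by (auto simp: module_vec_simps class_ring_simps)

lemma fd_space_carrier_vec: "fd_space (carrier_vec n)"
  unfolding fd_space_iff by (rule exI[of _ n]) auto

lemma left_half_append:
  assumes "u \<in> carrier_vec n" "v \<in> carrier_vec n"
  shows "left_half (u @\<^sub>v v) = u"
  using assms by (auto simp: left_half_def vec_first_def intro!: eq_vecI)

lemma right_half_append:
  assumes "u \<in> carrier_vec n" "v \<in> carrier_vec n"
  shows "right_half (u @\<^sub>v v) = v"
  using assms by (auto simp: right_half_def vec_last_def intro!: eq_vecI)

lemma append_smult:
  assumes "u \<in> carrier_vec n" "v \<in> carrier_vec m"
  shows "c \<cdot>\<^sub>v (u @\<^sub>v v) = (c \<cdot>\<^sub>v u) @\<^sub>v (c \<cdot>\<^sub>v v)"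
  using assms by (auto intro!: eq_vecI)

lemma linear_datum_src:
  assumes "linear_datum \<Phi>"
  obtains n where "src \<Phi> \<subseteq> carrier_vec n" "0\<^sub>v n \<in> src \<Phi>"
    "\<And>u v. u \<in> src \<Phi> \<Longrightarrow> v \<in> src \<Phi> \<Longrightarrow> u + v \<in> src \<Phi>"
    "\<And>c v. v \<in> src \<Phi> \<Longrightarrow> c \<cdot>\<^sub>v v \<in> src \<Phi>"
  using assms unfolding linear_datum_def fd_space_iff by blast

text \<open>The gluing conditions cut out a subspace because the equated forms are linear, which
  holds since \<open>S\<close> consists of indices of \<open>\<Phi>\<close>.\<close>

lemma linear_datum_self_join:
  fixes \<Phi> :: "'f::field datum"
  assumes lin: "linear_datum \<Phi>" and S: "S \<subseteq> idx \<Phi>"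
  shows "linear_datum (self_join \<Phi> S)"
proof -
  obtain n where n: "src \<Phi> \<subseteq> carrier_vec n" "0\<^sub>v n \<in> src \<Phi>"
    and add: "\<And>u v. u \<in> src \<Phi> \<Longrightarrow> v \<in> src \<Phi> \<Longrightarrow> u + v \<in> src \<Phi>"
    and smult: "\<And>c v. v \<in> src \<Phi> \<Longrightarrow> c \<cdot>\<^sub>v v \<in> src \<Phi>"
    using linear_datum_src[OF lin] by metis
  have lm: "lin_map (src \<Phi>) (tgt \<Phi> i) (form \<Phi> i)" if "i \<in> idx \<Phi>" for i
    using lin that by (auto simp: linear_datum_def)
  let ?J = "self_join \<Phi> S"
  have src: "w \<in> src ?J \<longleftrightarrow> (\<exists>u v. w = u @\<^sub>v v \<and> u \<in> src \<Phi> \<and> v \<in> src \<Phi> \<and>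
      (\<forall>i\<in>S. form \<Phi> i u = form \<Phi> i v))" for w
    by (auto simp: self_join_def)
  have add_app: "(u @\<^sub>v v) + (u' @\<^sub>v v') = (u + u') @\<^sub>v (v + v')"
    if "u \<in> src \<Phi>" "v \<in> src \<Phi>" "u' \<in> src \<Phi>" "v' \<in> src \<Phi>" for u v u' v'
    using append_vec_add that n by blast
  have smult_app: "c \<cdot>\<^sub>v (u @\<^sub>v v) = (c \<cdot>\<^sub>v u) @\<^sub>v (c \<cdot>\<^sub>v v)"
    if "u \<in> src \<Phi>" "v \<in> src \<Phi>" for c u v
    using append_smult that n by blast
  have halves: "left_half (u @\<^sub>v v) = u" "right_half (u @\<^sub>v v) = v"
    if "u \<in> src \<Phi>" "v \<in> src \<Phi>" for u v
    using left_half_append right_half_append that n by blast+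
  have "fd_space (src ?J)"
    unfolding fd_space_iff
  proof (intro exI[of _ "n + n"] conjI ballI allI)
    show "src ?J \<subseteq> carrier_vec (n + n)"
    proof
      fix w assume "w \<in> src ?J"
      then obtain u v where "w = u @\<^sub>v v" "u \<in> src \<Phi>" "v \<in> src \<Phi>"
        unfolding src by blast
      then show "w \<in> carrier_vec (n + n)"
        using n(1) by (meson append_carrier_vec subsetD)
    qed
    have "0\<^sub>v (n + n) = 0\<^sub>v n @\<^sub>v (0\<^sub>v n :: 'f vec)"
      by (auto intro!: eq_vecI)
    then show "0\<^sub>v (n + n) \<in> src ?J"
      using n(2) unfolding src by blast
  next
    fix w w' assume "w \<in> src ?J" "w' \<in> src ?J"
    then obtain u v u' v' where uv: "w = u @\<^sub>v v" "w' = u' @\<^sub>v v'"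
      "u \<in> src \<Phi>" "v \<in> src \<Phi>" "u' \<in> src \<Phi>" "v' \<in> src \<Phi>"
      "\<forall>i\<in>S. form \<Phi> i u = form \<Phi> i v" "\<forall>i\<in>S. form \<Phi> i u' = form \<Phi> i v'"
      unfolding src by blast
    moreover have "form \<Phi> i (u + u') = form \<Phi> i (v + v')" if "i \<in> S" for i
    proof -
      have "i \<in> idx \<Phi>" using that S by blast
      then show ?thesis using lm[of i] uv that unfolding lin_map_def by metis
    qed
    ultimately show "w + w' \<in> src ?J"
      unfolding src by (intro exI[of _ "u + u'"] exI[of _ "v + v'"]) (auto simp: add_app add)
  next
    fix c w assume "w \<in> src ?J"
    then obtain u v where uv: "w = u @\<^sub>v v" "u \<in> src \<Phi>" "v \<in> src \<Phi>"
      "\<forall>i\<in>S. form \<Phi> i u = form \<Phi> i v"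
      unfolding src by blast
    moreover have "form \<Phi> i (c \<cdot>\<^sub>v u) = form \<Phi> i (c \<cdot>\<^sub>v v)" if "i \<in> S" for i
    proof -
      have "i \<in> idx \<Phi>" using that S by blast
      then show ?thesis using lm[of i] uv that unfolding lin_map_def by metis
    qed
    ultimately show "c \<cdot>\<^sub>v w \<in> src ?J"
      unfolding src by (intro exI[of _ "c \<cdot>\<^sub>v u"] exI[of _ "c \<cdot>\<^sub>v v"]) (auto simp: smult_app smult)
  qed
  moreover have "lin_map (src ?J) (tgt \<Phi> i) (\<lambda>w. form \<Phi> i (left_half w))"
    "lin_map (src ?J) (tgt \<Phi> i) (\<lambda>w. form \<Phi> i (right_half w))" if "i \<in> idx \<Phi>" for i
    using lm[OF that] unfolding lin_map_def Ball_def src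
    by (auto simp: halves add_app smult_app add smult)
  ultimately show ?thesis
    using lin by (auto simp: linear_datum_def self_join_def)
qed

subsection \<open>Realisations by linear forms in four variables\<close>

text \<open>\<open>(a, b, c, d)\<close> stands for the linear form \<open>ax + by + cz + dw\<close>.\<close>

type_synonym 'f covec = "'f \<times> 'f \<times> 'f \<times> 'f"

definition lform :: "'f::field covec \<Rightarrow> 'f vec \<Rightarrow> 'f" where
  "lform A v = (case A of (a, b, c, d) \<Rightarrow> a * v $ 0 + b * v $ 1 + c * v $ 2 + d * v $ 3)"

lemma lform_simps:
  "lform (A + B) v = lform A v + lform B v" "lform (- A) v = - lform A v" "lform 0 v = 0"
  by (cases A; cases B; simp add: lform_def zero_prod_def algebra_simps)+

lemma lform_vec:
  assumes "u \<in> carrier_vec 4" "v \<in> carrier_vec 4"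
  shows "lform A (u + v) = lform A u + lform A v" "lform A (c \<cdot>\<^sub>v u) = c * lform A u"
  using assms by (cases A; simp add: lform_def algebra_simps)+

lemma lin_map_lforms:
  assumes "n = length As"
  shows "lin_map (carrier_vec 4) (carrier_vec n) (\<lambda>v. vec_of_list (map (\<lambda>A. lform A v) As))"
  unfolding lin_map_def
proof (intro conjI ballI allI)
  fix u v :: "'a vec" and c
  assume u: "u \<in> carrier_vec 4"
  show "vec_of_list (map (\<lambda>A. lform A u) As) \<in> carrier_vec n"
    by (rule carrier_vecI) (simp add: assms)
  show "vec_of_list (map (\<lambda>A. lform A (c \<cdot>\<^sub>v u)) As) = c \<cdot>\<^sub>v vec_of_list (map (\<lambda>A. lform A u) As)"
    by (rule eq_vecI) (simp_all add: vec_of_list_index lform_vec[OF u u])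
  assume v: "v \<in> carrier_vec 4"
  show "vec_of_list (map (\<lambda>A. lform A (u + v)) As) =
      vec_of_list (map (\<lambda>A. lform A u) As) + vec_of_list (map (\<lambda>A. lform A v) As)"
    by (rule eq_vecI) (simp_all add: vec_of_list_index lform_vec[OF u v])
qed

text \<open>The domain of \<open>\<theta>\<close> is the source of \<open>Psi a\<close>, so
  \<open>\<theta>\<close> can later serve as the linear map of a morphism; \<open>\<rho>\<close>
  records the pulled-back forms.\<close>

definition realises :: "'f::field datum \<Rightarrow> (index \<Rightarrow> 'f covec) \<Rightarrow> bool" where
  "realises \<Phi> \<rho> \<longleftrightarrow> (\<exists>\<theta>. lin_map (carrier_vec 4) (src \<Phi>) \<theta> \<and>
     (\<forall>i\<in>idx \<Phi>. \<forall>v\<in>carrier_vec 4. form \<Phi> i (\<theta> v) = vec_of_list [lform (\<rho> i) v]))"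

definition glue :: "(index \<Rightarrow> 'a) \<Rightarrow> (index \<Rightarrow> 'a) \<Rightarrow> index \<Rightarrow> 'a" where
  "glue \<rho> \<rho>' j = (case j of L i \<Rightarrow> \<rho> i | R i \<Rightarrow> \<rho>' i | _ \<Rightarrow> undefined)"

lemma glue_simps [simp]: "glue \<rho> \<rho>' (L i) = \<rho> i" "glue \<rho> \<rho>' (R i) = \<rho>' i"
  by (simp_all add: glue_def)

lemma idx_self_join: "idx (self_join \<Phi> S) = L ` (idx \<Phi> - S) \<union> R ` (idx \<Phi> - S)"
  by (simp add: self_join_def)

text \<open>Since \<open>\<theta> v\<close> and \<open>\<theta>' v\<close> satisfy the gluing
  equations on \<open>S\<close>, their concatenation lies in the joined space.\<close>

lemma realises_self_join:
  fixes \<Phi> :: "'f::field datum"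
  assumes lin: "linear_datum \<Phi>" and S: "S \<subseteq> idx \<Phi>"
    and real: "realises \<Phi> \<rho>" "realises \<Phi> \<rho>'" and agree: "\<And>i. i \<in> S \<Longrightarrow> \<rho> i = \<rho>' i"
  shows "realises (self_join \<Phi> S) (glue \<rho> \<rho>')"
proof -
  obtain n where n: "src \<Phi> \<subseteq> carrier_vec n"
    using linear_datum_src[OF lin] by metis
  obtain \<theta> where \<theta>: "lin_map (carrier_vec 4) (src \<Phi>) \<theta>"
    "\<And>i v. i \<in> idx \<Phi> \<Longrightarrow> v \<in> carrier_vec 4 \<Longrightarrow> form \<Phi> i (\<theta> v) = vec_of_list [lform (\<rho> i) v]"
    using real(1) unfolding realises_def by blast
  obtain \<theta>' where \<theta>': "lin_map (carrier_vec 4) (src \<Phi>) \<theta>'"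
    "\<And>i v. i \<in> idx \<Phi> \<Longrightarrow> v \<in> carrier_vec 4 \<Longrightarrow> form \<Phi> i (\<theta>' v) = vec_of_list [lform (\<rho>' i) v]"
    using real(2) unfolding realises_def by blast
  have in_src: "\<theta> v \<in> src \<Phi>" "\<theta>' v \<in> src \<Phi>" if "v \<in> carrier_vec 4" for v
    using \<theta>(1) \<theta>'(1) that by (auto simp: lin_map_def)
  then have car: "\<theta> v \<in> carrier_vec n" "\<theta>' v \<in> carrier_vec n" if "v \<in> carrier_vec 4" for v
    using n that by blast+
  have mem: "\<theta> v @\<^sub>v \<theta>' v \<in> src (self_join \<Phi> S)" if "v \<in> carrier_vec 4" for v
    using in_src[OF that] \<theta>(2)[OF _ that] \<theta>'(2)[OF _ that] agree S
    by (force simp: self_join_def)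
  have "lin_map (carrier_vec 4) (src (self_join \<Phi> S)) (\<lambda>v. \<theta> v @\<^sub>v \<theta>' v)"
    using \<theta>(1) \<theta>'(1) mem
    by (auto simp: lin_map_def append_vec_add[OF car(1) car(1) car(2) car(2)] append_smult[OF car])
  moreover have "form (self_join \<Phi> S) j (\<theta> v @\<^sub>v \<theta>' v) = vec_of_list [lform (glue \<rho> \<rho>' j) v]"
    if "j \<in> idx (self_join \<Phi> S)" "v \<in> carrier_vec 4" for j v
    using that(1) \<theta>(2)[OF _ that(2)] \<theta>'(2)[OF _ that(2)]
      left_half_append[OF car[OF that(2)]] right_half_append[OF car[OF that(2)]]
    by (auto simp: self_join_def)
  ultimately show ?thesis
    unfolding realises_def by blast
qed

section \<open>Scalar-valued data and the cube\<close>

definition scalar_datum :: "'f::field datum \<Rightarrow> bool" where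
  "scalar_datum \<Phi> \<longleftrightarrow> linear_datum \<Phi> \<and> (\<forall>i\<in>idx \<Phi>. tgt \<Phi> i = carrier_vec 1)"

lemma scalar_datum_self_join:
  assumes "scalar_datum \<Phi>" "S \<subseteq> idx \<Phi>"
  shows "scalar_datum (self_join \<Phi> S)"
  using assms linear_datum_self_join[of \<Phi> S]
  by (auto simp: scalar_datum_def self_join_def)

lemma idx_U3: "idx U3 = {Cube 0 0 0, Cube 0 0 1, Cube 0 1 0, Cube 0 1 1,
    Cube 1 0 0, Cube 1 0 1, Cube 1 1 0, Cube 1 1 1}"
  by (auto simp: U3_def)

lemma scalar_datum_U3: "scalar_datum (U3 :: 'f::field datum)"
proof -
  have "finite (idx (U3 :: 'f datum))"
    unfolding idx_U3 by simp
  moreover have "lin_map (carrier_vec 4) (carrier_vec 1) (form (U3 :: 'f datum) i)"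
    if i_in: "i \<in> idx (U3 :: 'f datum)" for i
  proof -
    obtain a b c where i: "i = Cube a b c"
      using i_in unfolding idx_U3 by blast
    have "form (U3 :: 'f datum) i =
        (\<lambda>v. vec_of_list (map (\<lambda>A. lform A v) [(1, of_nat a, of_nat b, of_nat c)]))"
      by (simp add: i U3_def lform_def)
    then show ?thesis
      by (simp only:) (rule lin_map_lforms, simp)
  qed
  ultimately show ?thesis
    by (auto simp: scalar_datum_def linear_datum_def fd_space_carrier_vec U3_def)
qed

text \<open>With base point \<open>A + B + C\<close> and steps \<open>- A\<close>,
  \<open>- B\<close>, \<open>- C\<close>, each coordinate equal to 1 cancels one summand, so the
  opposite face does not see that form.\<close>

lemma realises_U3:
  fixes A B C :: "'f::field covec"
  shows "realises U3 (\<lambda>j. case j of Cube a b c \<Rightarrow>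
     (if a = 0 then A else 0) + (if b = 0 then B else 0) + (if c = 0 then C else 0) | _ \<Rightarrow> 0)"
proof -
  let ?\<theta> = "\<lambda>v. vec_of_list [lform (A + B + C) v, lform (- A) v, lform (- B) v, lform (- C) v]"
  have "lin_map (carrier_vec 4) (src U3) ?\<theta>"
    using lin_map_lforms[of 4 "[A + B + C, - A, - B, - C]"] by (simp add: U3_def)
  moreover have "form U3 j (?\<theta> v) = vec_of_list [lform (case j of Cube a b c \<Rightarrow>
     (if a = 0 then A else 0) + (if b = 0 then B else 0) + (if c = 0 then C else 0) | _ \<Rightarrow> 0) v]"
    if "j \<in> idx (U3 :: 'f datum)" for j v
    using that by (auto simp: U3_def lform_simps vec_of_list_index numeral_3_eq_3 numeral_2_eq_2)
  ultimately show ?thesis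
    unfolding realises_def by blast
qed


subsection \<open>Parallelograms\<close>

text \<open>Keeps the 1 in cube indices and in \<open>carrier_vec 1\<close> from turning into
  \<open>Suc 0\<close>.\<close>

declare One_nat_def [simp del]

text \<open>The first joining removes the face with first coordinate 1, the next one the remaining
  vertices with second coordinate 1. What survives is four copies each of \<open>000\<close> and
  \<open>001\<close>.\<close>

definition square_datum :: "'f::field datum" where
  "square_datum = self_join U3 {Cube 1 0 0, Cube 1 0 1, Cube 1 1 0, Cube 1 1 1}"

definition parallelogram_datum :: "'f::field datum" where
  "parallelogram_datum = self_join square_datum
     {L (Cube 0 1 0), L (Cube 0 1 1), R (Cube 0 1 0), R (Cube 0 1 1)}"

lemma idx_square_datum:
  "idx square_datum =
     {L (Cube 0 0 0), L (Cube 0 0 1), L (Cube 0 1 0), L (Cube 0 1 1),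
      R (Cube 0 0 0), R (Cube 0 0 1), R (Cube 0 1 0), R (Cube 0 1 1)}"
  unfolding square_datum_def idx_self_join idx_U3 by auto

lemma idx_parallelogram_datum:
  "idx parallelogram_datum =
     {L (L (Cube 0 0 0)), L (R (Cube 0 0 0)), R (L (Cube 0 0 0)), R (R (Cube 0 0 0)),
      L (L (Cube 0 0 1)), L (R (Cube 0 0 1)), R (L (Cube 0 0 1)), R (R (Cube 0 0 1))}"
  unfolding parallelogram_datum_def idx_self_join idx_square_datum by auto

lemma scalar_datum_square: "scalar_datum (square_datum :: 'f::field datum)"
  unfolding square_datum_def by (rule scalar_datum_self_join[OF scalar_datum_U3]) (simp add: idx_U3)

lemma scalar_datum_parallelogram: "scalar_datum (parallelogram_datum :: 'f::field datum)"
  unfolding parallelogram_datum_def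
  by (rule scalar_datum_self_join[OF scalar_datum_square]) (simp add: idx_square_datum)

definition vertex_forms ::
  "(index \<Rightarrow> 'f::field covec) \<Rightarrow> 'f covec \<Rightarrow> 'f covec \<Rightarrow> 'f covec \<Rightarrow> 'f covec \<Rightarrow> bool" where
  "vertex_forms \<rho> A B C D \<longleftrightarrow> realises parallelogram_datum \<rho> \<and>
     \<rho> (L (L (Cube 0 0 0))) = A \<and> \<rho> (L (R (Cube 0 0 0))) = B \<and>
     \<rho> (R (L (Cube 0 0 0))) = C \<and> \<rho> (R (R (Cube 0 0 0))) = D \<and>
     \<rho> (L (L (Cube 0 0 1))) = 0 \<and> \<rho> (L (R (Cube 0 0 1))) = B - A \<and>
     \<rho> (R (L (Cube 0 0 1))) = C - A \<and> \<rho> (R (R (Cube 0 0 1))) = D - A"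

text \<open>The first seam does not see \<open>X\<close> and the second does not see
  \<open>Y\<close>, so \<open>X\<close> in \<open>{0, B - A}\<close> and \<open>Y\<close> in
  \<open>{0, C - A}\<close> vary independently over the four copies. The copies of
  \<open>001\<close> lack the summand \<open>A\<close>.\<close>

lemma vertex_forms_exist:
  fixes A B C D :: "'f::field covec"
  assumes "A + D = B + C"
  shows "\<exists>\<rho>. vertex_forms \<rho> A B C D"
proof -
  define cube where "cube X Y = (\<lambda>j. case j of Cube a b c \<Rightarrow>
     (if a = 0 then X else 0) + (if b = 0 then Y else 0) + (if c = 0 then A else 0) | _ \<Rightarrow> 0)"
    for X Y :: "'f covec"
  have cube: "realises U3 (cube X Y)" for X Y
    unfolding cube_def by (rule realises_U3)
  have cubes: "realises square_datum (glue (cube X Y) (cube X' Y))" for X X' Y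
    unfolding square_datum_def using scalar_datum_U3[where 'f = 'f] by (intro realises_self_join cube)
      (auto simp: scalar_datum_def idx_U3 cube_def)
  let ?\<rho> = "glue (glue (cube 0 0) (cube (B - A) 0)) (glue (cube 0 (C - A)) (cube (B - A) (C - A)))"
  have "realises parallelogram_datum ?\<rho>"
    unfolding parallelogram_datum_def using scalar_datum_square[where 'f = 'f]
    by (intro realises_self_join cubes) (auto simp: scalar_datum_def idx_square_datum cube_def)
  moreover have "D = B + C - A"
    using assms by (metis add_diff_cancel_left')
  then have "(B - A) + (C - A) = D - A"
    by simp
  ultimately show ?thesis
    unfolding vertex_forms_def by (intro exI[of _ ?\<rho>]) (simp add: cube_def)
qed

text \<open>A function of a separated form can be absorbed into \<open>\<phi>\<^sub>3\<close> or \<open>\<phi>\<^sub>4\<close>.\<close>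

definition separated :: "'f::field covec \<Rightarrow> bool" where
  "separated A \<longleftrightarrow> (case A of (_, _, c, d) \<Rightarrow> c = 0 \<or> d = 0)"

text \<open>In the final joining of the two chains, equal forms are glued away and separated ones
  survive to be absorbed.\<close>

definition compatible :: "'f::field covec \<Rightarrow> 'f covec \<Rightarrow> bool" where
  "compatible A B \<longleftrightarrow> A = B \<or> separated A \<and> separated B"

subsection \<open>Chains\<close>

text \<open>
  \<open>links \<Phi> S e X Y\<close> describes two realisations of \<open>\<Phi> +\<^sub>S \<Phi>\<close> at once, each given by its two halves:
  \<open>(\<rho>, \<tau>)\<close> for the chain starting at \<open>f(x + az + w)\<close>, \<open>(\<rho>', \<tau>')\<close> for the one starting at
  \<open>f(y + z + aw)\<close>. \<open>X\<close> and \<open>Y\<close> are the pairs of forms at the two ends \<open>L e\<close> and \<open>R e\<close>. Keeping the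
  halves apart makes the reversal of a chain trivial; it is needed because a self-joining glues
  two copies of the same end.
\<close>

definition links :: "'f::field datum \<Rightarrow> index set \<Rightarrow> index \<Rightarrow>
    'f covec \<times> 'f covec \<Rightarrow> 'f covec \<times> 'f covec \<Rightarrow> bool" where
  "links \<Phi> S e X Y \<longleftrightarrow> (\<exists>\<rho> \<rho>' \<tau> \<tau>'.
     realises \<Phi> \<rho> \<and> realises \<Phi> \<rho>' \<and> realises \<Phi> \<tau> \<and> realises \<Phi> \<tau>' \<and>
     X = (\<rho> e, \<rho>' e) \<and> Y = (\<tau> e, \<tau>' e) \<and>
     (\<forall>i\<in>S. \<rho> i = \<tau> i \<and> \<rho>' i = \<tau>' i) \<and>
     (\<forall>i\<in>idx \<Phi> - S - {e}. compatible (\<rho> i) (\<rho>' i) \<and> compatible (\<tau> i) (\<tau>' i)))"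

lemma links_sym:
  assumes "links \<Phi> S e X Y"
  shows "links \<Phi> S e Y X"
proof -
  obtain \<rho> \<rho>' \<tau> \<tau>' where
    "realises \<Phi> \<rho>" "realises \<Phi> \<rho>'" "realises \<Phi> \<tau>" "realises \<Phi> \<tau>'"
    "X = (\<rho> e, \<rho>' e)" "Y = (\<tau> e, \<tau>' e)" "\<forall>i\<in>S. \<rho> i = \<tau> i \<and> \<rho>' i = \<tau>' i"
    "\<forall>i\<in>idx \<Phi> - S - {e}. compatible (\<rho> i) (\<rho>' i) \<and> compatible (\<tau> i) (\<tau>' i)"
    using assms unfolding links_def by blast
  then show ?thesis
    unfolding links_def
    by (intro exI[of _ \<tau>] exI[of _ \<tau>'] exI[of _ \<rho>] exI[of _ \<rho>'] conjI ballI) metis+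
qed

lemma links_realises_self_join:
  assumes "links \<Phi> S e X Y" "linear_datum \<Phi>" "S \<subseteq> idx \<Phi>"
  obtains \<rho> \<rho>' where "realises (self_join \<Phi> S) \<rho>" "realises (self_join \<Phi> S) \<rho>'"
    "X = (\<rho> (L e), \<rho>' (L e))" "Y = (\<rho> (R e), \<rho>' (R e))"
    "\<And>i. i \<in> idx (self_join \<Phi> S) - {L e, R e} \<Longrightarrow> compatible (\<rho> i) (\<rho>' i)"
proof -
  obtain \<rho> \<rho>' \<tau> \<tau>' where *:
    "realises \<Phi> \<rho>" "realises \<Phi> \<rho>'" "realises \<Phi> \<tau>" "realises \<Phi> \<tau>'"
    "X = (\<rho> e, \<rho>' e)" "Y = (\<tau> e, \<tau>' e)" "\<forall>i\<in>S. \<rho> i = \<tau> i \<and> \<rho>' i = \<tau>' i"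
    "\<forall>i\<in>idx \<Phi> - S - {e}. compatible (\<rho> i) (\<rho>' i) \<and> compatible (\<tau> i) (\<tau>' i)"
    using assms(1) unfolding links_def by blast
  show ?thesis
  proof (rule that)
    show "realises (self_join \<Phi> S) (glue \<rho> \<tau>)" "realises (self_join \<Phi> S) (glue \<rho>' \<tau>')"
      using * assms(2,3) by (auto intro!: realises_self_join)
    show "compatible (glue \<rho> \<tau> i) (glue \<rho>' \<tau>' i)"
      if "i \<in> idx (self_join \<Phi> S) - {L e, R e}" for i
      using that *(8) by (auto simp: idx_self_join)
  qed (simp_all add: *)
qed

text \<open>The second chain is reversed, so that both carry \<open>M\<close> at \<open>R e\<close>;
  gluing there leaves \<open>X\<close> and \<open>Y\<close> at the two copies of
  \<open>L e\<close>.\<close>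

lemma links_self_join:
  assumes "links \<Phi> S e X M" "links \<Phi> S e M Y" "linear_datum \<Phi>" "S \<subseteq> idx \<Phi>"
  shows "links (self_join \<Phi> S) {R e} (L e) X Y"
proof -
  obtain \<rho> \<rho>' where \<rho>: "realises (self_join \<Phi> S) \<rho>" "realises (self_join \<Phi> S) \<rho>'"
    "X = (\<rho> (L e), \<rho>' (L e))" "M = (\<rho> (R e), \<rho>' (R e))"
    "\<And>i. i \<in> idx (self_join \<Phi> S) - {L e, R e} \<Longrightarrow> compatible (\<rho> i) (\<rho>' i)"
    using links_realises_self_join[OF assms(1,3,4)] by blast
  obtain \<tau> \<tau>' where \<tau>: "realises (self_join \<Phi> S) \<tau>" "realises (self_join \<Phi> S) \<tau>'"
    "Y = (\<tau> (L e), \<tau>' (L e))" "M = (\<tau> (R e), \<tau>' (R e))"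
    "\<And>i. i \<in> idx (self_join \<Phi> S) - {L e, R e} \<Longrightarrow> compatible (\<tau> i) (\<tau>' i)"
    using links_realises_self_join[OF links_sym[OF assms(2)] assms(3,4)] by blast
  have M: "\<rho> (R e) = \<tau> (R e)" "\<rho>' (R e) = \<tau>' (R e)"
    using \<rho>(4) \<tau>(4) by auto
  show ?thesis
    unfolding links_def
    by (intro exI[of _ \<rho>] exI[of _ \<rho>'] exI[of _ \<tau>] exI[of _ \<tau>'] conjI ballI)
      (use M in \<open>simp_all add: \<rho>(1-3) \<tau>(1-3) \<rho>(5) \<tau>(5)\<close>)
qed

text \<open>The terms \<open>(s, b)\<close> and \<open>(1, s * b)\<close> of the two chains, with
  coefficient \<open>\<kappa>\<close> at \<open>x\<close> and \<open>y\<close> respectively;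
  \<open>state 1 a 1\<close> gives the first two forms of \<open>Psi a\<close>.\<close>

definition state :: "'f::field \<Rightarrow> int \<Rightarrow> 'f \<Rightarrow> 'f covec \<times> 'f covec" where
  "state \<kappa> s b = ((\<kappa>, 0, of_int s, b), (0, \<kappa>, 1, of_int s * b))"

text \<open>The vertices of \<open>\<rho>\<close> share their \<open>w\<close> coefficient, those of
  \<open>\<tau>\<close>, \<open>\<rho>'\<close> and \<open>\<tau>'\<close> their \<open>z\<close>
  coefficient, so all differences are separated. The fourth vertices of \<open>\<rho>\<close> and
  \<open>\<rho>'\<close> are equal if \<open>\<delta> = 1\<close> and separated if
  \<open>\<delta> = 0\<close>; those of \<open>\<tau>\<close> and \<open>\<tau>'\<close> lack
  \<open>w\<close> and take up the change from \<open>\<kappa>\<close> to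
  \<open>\<kappa>'\<close>.\<close>

lemma links_halving:
  fixes b \<kappa> \<kappa>' :: "'f::field"
  assumes "\<delta> \<in> {0, 1}"
  shows "links parallelogram_datum {R (L (Cube 0 0 0)), L (R (Cube 0 0 0))} (L (L (Cube 0 0 0)))
    (state \<kappa> (2 * r - \<delta>) b) (state \<kappa>' r (2 * b))"
proof -
  define s d :: 'f where "s = of_int r" and "d = of_int \<delta>"
  have d: "d = 0 \<or> d = 1" using assms by (auto simp: d_def)
  have eqs: "(\<kappa>, 0, 2 * s - d, b) + (0, 0, d, b) = (\<kappa>, 0, s, b) + (0, 0, s, b)"
    "(\<kappa>', 0, s, 2 * b) + (\<kappa> - \<kappa>', 0, s, 0) = (\<kappa>, 0, s, b) + (0, 0, s, b)"
    "(0, \<kappa>, 1, (2 * s - d) * b) + (0, 0, 1, d * b) = (0, \<kappa>, 1, 2 * s * b) + (0, 0, 1, 0)"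
    "(0, \<kappa>', 1, s * (2 * b)) + (0, \<kappa> - \<kappa>', 1, 0) = (0, \<kappa>, 1, 2 * s * b) + (0, 0, 1, 0)"
    by (simp_all add: algebra_simps)
  obtain \<rho> \<tau> \<rho>' \<tau>' where
    "vertex_forms \<rho> (\<kappa>, 0, 2 * s - d, b) (\<kappa>, 0, s, b) (0, 0, s, b) (0, 0, d, b)"
    "vertex_forms \<tau> (\<kappa>', 0, s, 2 * b) (\<kappa>, 0, s, b) (0, 0, s, b) (\<kappa> - \<kappa>', 0, s, 0)"
    "vertex_forms \<rho>' (0, \<kappa>, 1, (2 * s - d) * b) (0, \<kappa>, 1, 2 * s * b) (0, 0, 1, 0) (0, 0, 1, d * b)"
    "vertex_forms \<tau>' (0, \<kappa>', 1, s * (2 * b)) (0, \<kappa>, 1, 2 * s * b) (0, 0, 1, 0) (0, \<kappa> - \<kappa>', 1, 0)"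
    using eqs[THEN vertex_forms_exist] by metis
  note * = this[unfolded vertex_forms_def]
  have st: "state \<kappa> (2 * r - \<delta>) b = ((\<kappa>, 0, 2 * s - d, b), (0, \<kappa>, 1, (2 * s - d) * b))"
    "state \<kappa>' r (2 * b) = ((\<kappa>', 0, s, 2 * b), (0, \<kappa>', 1, s * (2 * b)))"
    by (simp_all add: state_def s_def d_def)
  have "compatible (\<rho> i) (\<rho>' i) \<and> compatible (\<tau> i) (\<tau>' i)"
    if "i \<in> idx (parallelogram_datum :: 'f datum) - {R (L (Cube 0 0 0)), L (R (Cube 0 0 0))}
      - {L (L (Cube 0 0 0))}" for i
  proof -
    have "i \<in> {R (R (Cube 0 0 0)), L (L (Cube 0 0 1)), L (R (Cube 0 0 1)),
        R (L (Cube 0 0 1)), R (R (Cube 0 0 1))}"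
      using that unfolding idx_parallelogram_datum by blast
    then show ?thesis
      using d by (elim insertE emptyE disjE) (simp_all add: * compatible_def separated_def zero_prod_def)
  qed
  then show ?thesis
    unfolding links_def st
    by (intro exI[of _ \<rho>] exI[of _ \<rho>'] exI[of _ \<tau>] exI[of _ \<tau>']) (simp add: *)
qed

section \<open>Doubling of chains\<close>

primrec chain_end :: "nat \<Rightarrow> index" where
  "chain_end 0 = L (L (Cube 0 0 0))"
| "chain_end (Suc k) = L (chain_end k)"

primrec chain_seam :: "nat \<Rightarrow> index set" where
  "chain_seam 0 = {R (L (Cube 0 0 0)), L (R (Cube 0 0 0))}"
| "chain_seam (Suc k) = {R (chain_end k)}"

text \<open>\<open>chain k\<close> is one half of a chain of \<open>2 ^ k\<close> halvings, and
  \<open>chain (Suc k)\<close> is the whole. The first seam is the common diagonal, each later one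
  the far end.\<close>

primrec chain :: "nat \<Rightarrow> 'f::field datum" where
  "chain 0 = parallelogram_datum"
| "chain (Suc k) = self_join (chain k) (chain_seam k)"

lemma chain_indices:
  "chain_end k \<in> idx (chain k :: 'f::field datum) \<and> chain_end k \<notin> chain_seam k \<and>
    chain_seam k \<subseteq> idx (chain k :: 'f datum)"
  by (induction k) (auto simp: idx_parallelogram_datum idx_self_join image_iff)

lemma scalar_datum_chain: "scalar_datum (chain k :: 'f::field datum)"
  by (induction k) (simp_all add: scalar_datum_parallelogram scalar_datum_self_join chain_indices)

text \<open>The hypotheses say that \<open>r\<close> is \<open>s / 2 ^ 2 ^ k\<close> rounded up.
  Rounding up twice in succession amounts to rounding up once, so doubling the chain squares the
  divisor.\<close>

lemma links_chain:
  fixes b \<kappa> \<kappa>' :: "'f::field"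
  assumes "0 \<le> 2 ^ 2 ^ k * r - s" "2 ^ 2 ^ k * r - s < 2 ^ 2 ^ k"
  shows "links (chain k) (chain_seam k) (chain_end k) (state \<kappa> s b) (state \<kappa>' r (2 ^ 2 ^ k * b))"
  using assms
proof (induction k arbitrary: \<kappa> \<kappa>' s r b)
  case 0
  then have "2 * r - s \<in> {0, 1}" by auto
  from links_halving[OF this, of \<kappa> r b \<kappa>'] show ?case by simp
next
  case (Suc k)
  define N :: int where "N = 2 ^ 2 ^ k"
  have N: "2 ^ 2 ^ Suc k = N * N" "N > 0"
    by (simp_all add: N_def mult_2 power_add)
  \<comment> \<open>\<open>m\<close> is \<open>s / N\<close> rounded up, the value at the middle of
    the chain; \<open>q\<close> is the defect \<open>N * r - m\<close>.\<close>
  define q where "q = (N * N * r - s) div N"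
  define m where "m = N * r - q"
  have qm: "N * m - s = (N * N * r - s) mod N"
    unfolding m_def q_def by (simp add: algebra_simps minus_div_mult_eq_mod[symmetric])
  have "N * q \<le> N * N * r - s"
    using N(2) unfolding q_def by (simp add: minus_mod_eq_mult_div[symmetric])
  then have "N * q < N * N"
    using Suc.prems(2) unfolding N(1) by linarith
  then have "q < N"
    using N(2) by simp
  moreover have "0 \<le> q"
    using Suc.prems(1) N(2) unfolding N(1) q_def by (simp add: pos_imp_zdiv_nonneg_iff)
  ultimately have "links (chain k) (chain_seam k) (chain_end k) (state 0 m (2 ^ 2 ^ k * b))
      (state \<kappa>' r (2 ^ 2 ^ k * (2 ^ 2 ^ k * b)))"
    by (intro Suc.IH) (simp_all add: m_def N_def[symmetric])
  moreover have "links (chain k) (chain_seam k) (chain_end k) (state \<kappa> s b)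
      (state 0 m (2 ^ 2 ^ k * b))"
    using qm N(2) by (intro Suc.IH) (simp_all add: N_def[symmetric])
  ultimately have "links (self_join (chain k) (chain_seam k)) {R (chain_end k)} (L (chain_end k))
      (state \<kappa> s b) (state \<kappa>' r (2 ^ 2 ^ k * (2 ^ 2 ^ k * b)))"
    using scalar_datum_chain[of k, where 'f = 'f] chain_indices[of k, where 'f = 'f]
    by (intro links_self_join) (auto simp: scalar_datum_def)
  moreover have "2 ^ 2 ^ k * (2 ^ 2 ^ k * b) = 2 ^ 2 ^ Suc k * b"
    by (simp add: mult_2 power_add mult.assoc)
  ultimately show ?case by simp
qed


subsection \<open>Entailments\<close>

text \<open>Only the label of \<open>e\<close> is tracked, since the two labelled indices at the end
  are copies of it.\<close>

definition derivable :: "nat \<Rightarrow> index \<Rightarrow> 'f::field datum \<Rightarrow> bool" where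
  "derivable k e \<Phi> \<longleftrightarrow> scalar_datum \<Phi> \<and> e \<in> idx \<Phi> \<and>
     (\<exists>\<gamma>. entails U3 k \<gamma> \<Phi> \<and> \<gamma> e = Some (Cube 0 0 0, 0))"

lemma derivable_self_join:
  assumes "derivable k e \<Phi>" "S \<subseteq> idx \<Phi>" "e \<notin> S"
  shows "derivable (Suc k) (L e) (self_join \<Phi> S)"
proof -
  obtain \<gamma> where \<gamma>: "scalar_datum \<Phi>" "e \<in> idx \<Phi>" "entails U3 k \<gamma> \<Phi>" "\<gamma> e = Some (Cube 0 0 0, 0)"
    using assms(1) unfolding derivable_def by blast
  have "entails \<Phi> 1 (join_labelling \<Phi> S) (self_join \<Phi> S)"
    using \<gamma>(1) assms(2) by (intro self_joining) (simp_all add: scalar_datum_def)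
  from composition[OF \<gamma>(3) this] have "entails U3 (Suc k) (comp_labelling \<gamma> (join_labelling \<Phi> S)) (self_join \<Phi> S)"
    by (simp only: Suc_eq_plus1)
  moreover have "comp_labelling \<gamma> (join_labelling \<Phi> S) (L e) = Some (Cube 0 0 0, 0)"
    using \<gamma> assms(3) by (simp add: comp_labelling_def join_labelling_def)
  ultimately show ?thesis
    using scalar_datum_self_join[OF \<gamma>(1) assms(2)] \<gamma>(2) assms(3)
    by (auto simp: derivable_def idx_self_join)
qed

lemma derivable_square: "derivable 1 (L (Cube 0 0 0)) (square_datum :: 'f::field datum)"
proof -
  let ?S = "{Cube 1 0 0, Cube 1 0 1, Cube 1 1 0, Cube 1 1 1}"
  have "entails (U3 :: 'f datum) 1 (join_labelling (U3 :: 'f datum) ?S) square_datum"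
    using scalar_datum_U3[where 'f = 'f] unfolding square_datum_def
    by (intro self_joining) (simp_all add: scalar_datum_def idx_U3)
  moreover have "join_labelling (U3 :: 'f datum) ?S (L (Cube 0 0 0)) = Some (Cube 0 0 0, 0)"
    by (simp add: join_labelling_def idx_U3)
  ultimately show ?thesis
    using scalar_datum_square[where 'f = 'f] unfolding derivable_def by (auto simp: idx_square_datum)
qed

lemma derivable_chain: "derivable (2 + k) (chain_end k) (chain k :: 'f::field datum)"
proof (induction k)
  case 0
  have "derivable (Suc 1) (L (L (Cube 0 0 0))) (parallelogram_datum :: 'f datum)"
    unfolding parallelogram_datum_def
    by (rule derivable_self_join[OF derivable_square]) (simp_all add: idx_square_datum)
  then show ?case by (simp add: numeral_2_eq_2 One_nat_def)
next
  case (Suc k)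
  then show ?case
    using derivable_self_join[OF Suc] chain_indices[of k, where 'f = 'f] by simp
qed

section \<open>The morphism out of \<open>Psi a\<close>\<close>

lemma lin_map_vec3:
  "lin_map (carrier_vec 3) (carrier_vec 1)
     (\<lambda>u. vec_of_list [p * u $ 0 + q * u $ 1 + (r :: 'f::field) * u $ 2])"
  unfolding lin_map_def
proof (intro conjI ballI allI)
  fix u v :: "'f vec" and c
  assume u: "u \<in> carrier_vec 3"
  show "vec_of_list [p * u $ 0 + q * u $ 1 + r * u $ 2] \<in> carrier_vec 1"
    by (rule carrier_vecI) simp
  show "vec_of_list [p * (c \<cdot>\<^sub>v u) $ 0 + q * (c \<cdot>\<^sub>v u) $ 1 + r * (c \<cdot>\<^sub>v u) $ 2] =
      c \<cdot>\<^sub>v vec_of_list [p * u $ 0 + q * u $ 1 + r * u $ 2]"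
    using u by (intro eq_vecI) (simp_all add: vec_of_list_index algebra_simps)
  assume v: "v \<in> carrier_vec 3"
  show "vec_of_list [p * (u + v) $ 0 + q * (u + v) $ 1 + r * (u + v) $ 2] =
      vec_of_list [p * u $ 0 + q * u $ 1 + r * u $ 2] + vec_of_list [p * v $ 0 + q * v $ 1 + r * v $ 2]"
    using u v by (intro eq_vecI) (simp_all add: vec_of_list_index algebra_simps)
qed

lemma index_vec_of_list3:
  "vec_of_list [x, y, z] $ 0 = x" "vec_of_list [x, y, z] $ 1 = y" "vec_of_list [x, y, z] $ 2 = z"
  by (simp_all only: vec_of_list_index) simp_all

lemma linear_datum_Psi: "linear_datum (Psi a :: 'f::field datum)"
proof -
  have "lin_map (carrier_vec 4) (tgt (Psi a :: 'f datum) i) (form (Psi a) i)"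
    if "i \<in> idx (Psi a :: 'f datum)" for i
  proof -
    have i: "i \<in> {Num 1, Num 2, Num 3, Num 4}"
      using that by (simp add: Psi_def)
    have "form (Psi a :: 'f datum) i = (\<lambda>v. vec_of_list (map (\<lambda>A. lform A v)
        (if i = Num 1 then [(1, 0, of_int a, 1)] else if i = Num 2 then [(0, 1, 1, of_int a)]
         else if i = Num 3 then [(1, 0, 0, 0), (0, 1, 0, 0), (0, 0, 0, 1)]
         else [(1, 0, 0, 0), (0, 1, 0, 0), (0, 0, 1, 0)])))"
      by (simp add: Psi_def lform_def fun_eq_iff del: vec_of_list_map)
    moreover have "tgt (Psi a :: 'f datum) i = carrier_vec (if i = Num 1 \<or> i = Num 2 then 1 else 3)"
      by (simp add: Psi_def)
    ultimately show ?thesis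
      by (simp only:) (rule lin_map_lforms, simp)
  qed
  then show ?thesis
    by (auto simp: linear_datum_def Psi_def fd_space_carrier_vec)
qed

lemma entails_Psi:
  fixes \<Phi> :: "'f::field datum"
  assumes \<Phi>: "scalar_datum \<Phi>" and real: "realises \<Phi> \<rho>"
    and e: "e \<in> idx \<Phi>" "e' \<in> idx \<Phi>" "e \<noteq> e'"
    and \<rho>e: "\<rho> e = (1, 0, of_int a, 1)" "\<rho> e' = (0, 1, 1, of_int a)"
    and sep: "\<And>i. i \<in> idx \<Phi> \<Longrightarrow> i \<noteq> e \<Longrightarrow> i \<noteq> e' \<Longrightarrow> separated (\<rho> i)"
  shows "entails \<Phi> 0 [Num 1 \<mapsto> (e, 0), Num 2 \<mapsto> (e', 0)] (Psi a)"
proof -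
  obtain \<theta> where \<theta>: "lin_map (carrier_vec 4) (src \<Phi>) \<theta>"
    "\<And>i v. i \<in> idx \<Phi> \<Longrightarrow> v \<in> carrier_vec 4 \<Longrightarrow> form \<Phi> i (\<theta> v) = vec_of_list [lform (\<rho> i) v]"
    using real unfolding realises_def by blast
  \<comment> \<open>A form without \<open>z\<close> factors through \<open>(x, y, w)\<close>; any
    other separated form lacks \<open>w\<close> and factors through
    \<open>(x, y, z)\<close>.\<close>
  define z_free where "z_free i \<longleftrightarrow> fst (snd (snd (\<rho> i))) = 0" for i
  define \<alpha> where "\<alpha> i = Some (if i = e then Num 1 else if i = e' then Num 2
      else if z_free i then Num 3 else Num 4)" for i
  \<comment> \<open>The third coordinate of the chosen target is \<open>w\<close> if
    \<open>r = 0\<close> and \<open>z\<close> otherwise.\<close>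
  define \<sigma> where "\<sigma> i = (if i = e \<or> i = e' then (\<lambda>u. u)
      else case \<rho> i of (p, q, r, s) \<Rightarrow>
        (\<lambda>u. vec_of_list [p * u $ 0 + q * u $ 1 + (if r = 0 then s else r) * u $ 2]))" for i
  have tgt: "tgt \<Phi> i = carrier_vec 1" if "i \<in> idx \<Phi>" for i
    using \<Phi> that by (simp add: scalar_datum_def)
  have tgt_Psi: "tgt_star (Psi a :: 'f datum) (\<alpha> i) = carrier_vec (if i = e \<or> i = e' then 1 else 3)" for i
    by (simp add: tgt_star_def \<alpha>_def Psi_def)
  have "lin_map (tgt_star (Psi a) (\<alpha> i)) (tgt \<Phi> i) (\<sigma> i)" if "i \<in> idx \<Phi>" for i
  proof (cases "i = e \<or> i = e'")
    case True
    then show ?thesis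
      unfolding tgt_Psi tgt[OF that] by (simp add: \<sigma>_def lin_map_def)
  next
    case False
    obtain p q r s where "\<rho> i = (p, q, r, s)"
      by (metis surj_pair)
    then show ?thesis
      using False lin_map_vec3[where 'f = 'f] unfolding tgt_Psi tgt[OF that] by (simp add: \<sigma>_def)
  qed
  moreover have "\<sigma> i (form_star (Psi a) (\<alpha> i) v) = form \<Phi> i (\<theta> v)"
    if i: "i \<in> idx \<Phi>" and v: "v \<in> carrier_vec 4" for i v
  proof (cases "i = e \<or> i = e'")
    case True
    then show ?thesis
      using \<rho>e e(3) by (auto simp: \<theta>(2)[OF i v] \<sigma>_def form_star_def \<alpha>_def Psi_def lform_def)
  next
    case False
    obtain p q r s where \<rho>i: "\<rho> i = (p, q, r, s)"
      by (metis surj_pair)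
    then have "r = 0 \<or> s = 0"
      using sep[OF i] False by (simp add: separated_def)
    then show ?thesis
      using False \<rho>i by (auto simp: \<theta>(2)[OF i v] \<sigma>_def form_star_def \<alpha>_def Psi_def lform_def
          z_free_def index_vec_of_list3 simp del: vec_of_list_Cons)
  qed
  ultimately have mor: "datum_morphism (Psi a) \<Phi> \<alpha> \<theta> \<sigma>"
    using \<theta>(1) unfolding datum_morphism_def by (simp add: \<alpha>_def Psi_def)
  \<comment> \<open>The dimensions 1 and 3 differ, so no absorbed index is respected and the
    labelling has exactly two entries.\<close>
  have ne: "carrier_vec 1 \<noteq> (carrier_vec 3 :: 'f vec set)"
  proof
    assume "carrier_vec 1 = (carrier_vec 3 :: 'f vec set)"
    then have "0\<^sub>v 1 \<in> (carrier_vec 3 :: 'f vec set)"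
      by (metis zero_carrier_vec)
    then have "dim_vec (0\<^sub>v 1 :: 'f vec) = 3"
      by (rule carrier_vecD)
    then show False by simp
  qed
  have "respects_idx (Psi a) \<Phi> \<alpha> \<sigma> i \<longleftrightarrow> i = e \<or> i = e'" if "i \<in> idx \<Phi>" for i
  proof (cases "i = e \<or> i = e'")
    case True
    then show ?thesis
      using e
      by (auto simp: respects_idx_def tgt \<sigma>_def \<alpha>_def tgt_star_def Psi_def split: if_splits)
  next
    case False
    then show ?thesis
      using ne by (simp add: respects_idx_def tgt_Psi tgt[OF that])
  qed
  then have "Map.graph [Num 1 \<mapsto> (e, 0 :: nat), Num 2 \<mapsto> (e', 0)] =
      {(l, (i, 0)) | l i. i \<in> idx \<Phi> \<and> respects_idx (Psi a) \<Phi> \<alpha> \<sigma> i \<and> \<alpha> i = Some l}"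
    using e by (auto simp: Map.graph_def \<alpha>_def split: if_splits)
  with mor show ?thesis
    using \<Phi> linear_datum_Psi[where 'f = 'f] by (intro morphism) (auto simp: scalar_datum_def)
qed

text \<open>One joining completes the chain, another glues its two realisations; the right copy in
  the latter gives \<open>Num 2\<close> the label 1.\<close>

lemma entails_Psi_of_links:
  fixes \<Phi> :: "'f::field datum"
  assumes der: "derivable k e \<Phi>" and S: "S \<subseteq> idx \<Phi>" "e \<notin> S"
    and links: "links \<Phi> S e ((1, 0, of_int a, 1), (0, 1, 1, of_int a)) Y"
    and Y: "compatible (fst Y) (snd Y)"
  shows "entails U3 (k + 2) [Num 1 \<mapsto> (Cube 0 0 0, 0), Num 2 \<mapsto> (Cube 0 0 0, 1)] (Psi a :: 'f datum)"
proof -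
  define \<Xi> where "\<Xi> = self_join \<Phi> S"
  have "linear_datum \<Phi>"
    using der by (simp add: derivable_def scalar_datum_def)
  from links_realises_self_join[OF links this S(1)]
  obtain \<rho> \<rho>' where \<rho>: "realises \<Xi> \<rho>" "realises \<Xi> \<rho>'"
    "((1, 0, of_int a, 1), (0, 1, 1, of_int a)) = (\<rho> (L e), \<rho>' (L e))" "Y = (\<rho> (R e), \<rho>' (R e))"
    "\<And>i. i \<in> idx \<Xi> - {L e, R e} \<Longrightarrow> compatible (\<rho> i) (\<rho>' i)"
    unfolding \<Xi>_def by blast
  have \<rho>e: "\<rho> (L e) = (1, 0, of_int a, 1)" "\<rho>' (L e) = (0, 1, 1, of_int a)"
    using \<rho>(3) by simp_all
  have compat: "compatible (\<rho> i) (\<rho>' i)" if "i \<in> idx \<Xi>" "i \<noteq> L e" for i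
    using that \<rho>(4,5) Y by (cases "i = R e") simp_all
  \<comment> \<open>By compatibility, every index outside \<open>T\<close> other than
    \<open>L e\<close> has separated forms in both realisations.\<close>
  define T where "T = {i \<in> idx \<Xi> - {L e}. \<rho> i = \<rho>' i}"
  have "derivable (Suc k) (L e) \<Xi>"
    unfolding \<Xi>_def by (rule derivable_self_join[OF der S])
  then obtain \<gamma> where \<Xi>: "scalar_datum \<Xi>" "L e \<in> idx \<Xi>"
    and \<gamma>: "entails U3 (Suc k) \<gamma> \<Xi>" "\<gamma> (L e) = Some (Cube 0 0 0, 0)"
    unfolding derivable_def by blast
  have T: "T \<subseteq> idx \<Xi>" "L e \<notin> T"
    by (auto simp: T_def)
  have "entails \<Xi> 1 (join_labelling \<Xi> T) (self_join \<Xi> T)"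
    using \<Xi> T by (intro self_joining) (simp_all add: scalar_datum_def)
  moreover have "entails (self_join \<Xi> T) 0 [Num 1 \<mapsto> (L (L e), 0), Num 2 \<mapsto> (R (L e), 0)] (Psi a)"
  proof (rule entails_Psi)
    show "scalar_datum (self_join \<Xi> T)"
      by (rule scalar_datum_self_join[OF \<Xi>(1) T(1)])
    show "realises (self_join \<Xi> T) (glue \<rho> \<rho>')"
      using \<Xi>(1) T(1) \<rho>(1,2) by (intro realises_self_join) (auto simp: scalar_datum_def T_def)
    show "separated (glue \<rho> \<rho>' i)"
      if "i \<in> idx (self_join \<Xi> T)" "i \<noteq> L (L e)" "i \<noteq> R (L e)" for i
      using that compat[unfolded compatible_def] by (auto simp: idx_self_join T_def; blast)
  qed (use \<rho>e \<Xi>(2) T(2) in \<open>auto simp: idx_self_join\<close>)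
  ultimately have "entails U3 (Suc k + (1 + 0)) (comp_labelling \<gamma> (comp_labelling (join_labelling \<Xi> T)
      [Num 1 \<mapsto> (L (L e), 0), Num 2 \<mapsto> (R (L e), 0)])) (Psi a :: 'f datum)"
    by (rule composition[OF \<gamma>(1) composition])
  then show ?thesis
    by (rule weakening)
      (use \<gamma>(2) \<Xi>(2) T in \<open>auto simp: map_le_def comp_labelling_def join_labelling_def\<close>)
qed

lemma entails_Psi_of_bound:
  assumes "\<bar>a\<bar> < 2 ^ 2 ^ k"
  shows "entails U3 (4 + k) [Num 1 \<mapsto> (Cube 0 0 0, 0), Num 2 \<mapsto> (Cube 0 0 0, 1)]
    (Psi a :: 'f::field datum)"
proof -
  \<comment> \<open>This is \<open>a / 2 ^ 2 ^ k\<close> rounded up. At the far end, with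
    \<open>\<kappa>' = 0\<close>, the two forms coincide if \<open>r = 1\<close> and are separated
    if \<open>r = 0\<close>.\<close>
  define r :: int where "r = (if a > 0 then 1 else 0)"
  have "links (chain k :: 'f datum) (chain_seam k) (chain_end k)
      (state 1 a 1) (state 0 r (2 ^ 2 ^ k * 1))"
    by (rule links_chain) (use assms in \<open>auto simp: r_def\<close>)
  moreover have "state (1 :: 'f) a 1 = ((1, 0, of_int a, 1), (0, 1, 1, of_int a))"
    by (simp add: state_def)
  moreover have "compatible (fst (state (0 :: 'f) r (2 ^ 2 ^ k * 1))) (snd (state 0 r (2 ^ 2 ^ k * 1)))"
    by (simp add: state_def r_def compatible_def separated_def)
  ultimately have "entails U3 ((2 + k) + 2) [Num 1 \<mapsto> (Cube 0 0 0, 0), Num 2 \<mapsto> (Cube 0 0 0, 1)]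
      (Psi a :: 'f datum)"
    using chain_indices[of k, where 'f = 'f] by (intro entails_Psi_of_links[OF derivable_chain]) auto
  moreover have "(2 + k) + 2 = 4 + k"
    by simp
  ultimately show ?thesis by (simp only:)
qed

section \<open>Comparison with the logarithmic bound\<close>

lemma join_bound_suffices: "\<exists>k. \<bar>a\<bar> < 2 ^ 2 ^ k \<and> 4 + k \<le> join_bound a"
proof (cases "\<bar>a\<bar> \<ge> 4")
  \<comment> \<open>Here \<open>2 ^ 2 ^ 1 = 4\<close> and \<open>4 + 1 = 5\<close>.\<close>
  case False
  then show ?thesis
    by (intro exI[of _ 1]) (simp add: join_bound_def)
next
  case True
  define n where "n = nat \<lfloor>log 2 (real_of_int (\<bar>a\<bar> - 1))\<rfloor>"
  define m where "m = nat \<lfloor>log 2 (real n)\<rfloor>"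
  \<comment> \<open>From \<open>\<bar>a\<bar> - 1 \<ge> 3\<close> follows \<open>n \<ge> 1\<close>,
    so the outer logarithm is nonnegative and \<open>nat\<close> truncates nothing.\<close>
  have "1 \<le> log 2 (real_of_int (\<bar>a\<bar> - 1))"
    using True by (subst le_log_iff) auto
  then have n: "\<lfloor>log 2 (real_of_int (\<bar>a\<bar> - 1))\<rfloor> = int n" "n \<ge> 1"
    by (auto simp: n_def le_nat_iff le_floor_iff)
  have "log 2 (real_of_int (\<bar>a\<bar> - 1)) < real n + 1"
    using n(1) by linarith
  then have "real_of_int (\<bar>a\<bar> - 1) < 2 powr (real n + 1)"
    using True by (subst (asm) log_less_iff) auto
  also have "\<dots> = 2 ^ (n + 1)"
    by (simp add: powr_add powr_realpow power_add)
  finally have "real_of_int (\<bar>a\<bar> - 1) < real_of_int (2 ^ (n + 1))"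
    by simp
  then have a: "\<bar>a\<bar> - 1 < 2 ^ (n + 1)"
    by (simp only: of_int_less_iff)
  have "0 \<le> log 2 (real n)"
    using n(2) by simp
  then have "log 2 (real n) < real m + 1"
    unfolding m_def by linarith
  then have "real n < 2 powr (real m + 1)"
    using n(2) by (subst (asm) log_less_iff) auto
  also have "\<dots> = real (2 ^ (m + 1))"
    by (simp add: powr_add powr_realpow power_add)
  finally have "n < 2 ^ (m + 1)"
    by (simp only: of_nat_less_iff)
  \<comment> \<open>The extra 1 in the exponent pays for passing from
    \<open>\<bar>a\<bar> - 1 < 2 ^ (n + 1)\<close> to
    \<open>\<bar>a\<bar> < 2 ^ (n + 2)\<close>.\<close>
  then have "n + 2 \<le> 2 ^ (m + 2)"
    using one_le_power[of "2::nat" m] by (simp add: power_add)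
  have "(2::int) ^ (n + 2) = 2 * 2 ^ (n + 1)"
    by (simp add: power_add)
  moreover have "1 \<le> (2::int) ^ (n + 1)"
    by (rule one_le_power) simp
  ultimately have "\<bar>a\<bar> < 2 ^ (n + 2)"
    using a by linarith
  also have "\<dots> \<le> 2 ^ 2 ^ (m + 2)"
    using \<open>n + 2 \<le> 2 ^ (m + 2)\<close> by (intro power_increasing) auto
  finally have "\<bar>a\<bar> < 2 ^ 2 ^ (m + 2)" .
  moreover have "join_bound a = 6 + m"
    unfolding join_bound_def n(1) m_def using True by simp
  ultimately show ?thesis
    by (intro exI[of _ "m + 2"]) simp
qed

theorem theorem3p12:
  fixes a :: int
  assumes "CARD('p::prime_card) > 2"
  shows "entails (U3 :: 'p mod_ring datum) (join_bound a)
           [Num 1 \<mapsto> (Cube 0 0 0, 0), Num 2 \<mapsto> (Cube 0 0 0, 1)] (Psi a)"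
proof -
  obtain k where "\<bar>a\<bar> < 2 ^ 2 ^ k" "4 + k \<le> join_bound a"
    using join_bound_suffices by blast
  then show ?thesis
    using entails_Psi_of_bound weakening[OF _ _ map_le_refl] by blast
qed

end
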